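(* If a metric space $(X,d)$ admits an $\varepsilon>0$ such that $\exp(\varepsilon d)$ is a kernel of hyperbolic type, then $(X,d)$ is $3$-coarsely strongly-$\varepsilon$-hyperbolic. In particular, $X$ is Gromov-hyperbolic, the Gromov product extends continuously to the boundary, and all visual metametrics (for the parameter $\varepsilon$) are metrics on $\partial X$ and are all Möbius equivalent (they induce the same metric cross-ratio).
   Context: A kernel on $X$ is a continuous symmetric function $K\colon X\times X\to\mathbb R$; it is of hyperbolic type when it is nonnegative, $K(x,x)=1$ for all $x$, and $\sum_{i,j=1}^n\lambda_i\lambda_jK(x_i,x_j)\le\big(\sum_{k=1}^n\lambda_kK(x_0,x_k)\big)^2$ for all $n$, $x_0,\dots,x_n\in X$, $\lambda\in\mathbb R^n$. For $\varepsilon>0$ and $C\in\mathbb R$, $(X,d)$ is $C$-coarsely strongly-$\varepsilon$-hyperbolic when for all $x_1,x_2,x_3,x_4\in X$, with $d_{ij}=d(x_i,x_j)$ and $M=\max_{i,j}d_{ij}$: $\exp\frac\varepsilon2(d_{13}+d_{24})\le\exp\frac\varepsilon2(d_{12}+d_{34})+\exp\frac\varepsilon2(d_{14}+d_{23})+C\exp(\frac\varepsilon2M)$. The Gromov product is $(x\mid y)_o=\frac12(d(o,x)+d(o,y)-d(x,y))$; $\partial X$ is the Gromov boundary; the visual metametric at $o$ for the parameter $\varepsilon$ is (the extension to the boundary of) $d_o^\varepsilon(x,y)=\exp(-\varepsilon(x\mid y)_o)$. The metric cross-ratio of a metric $\delta$ is $\frac{\delta(a,a')\delta(b,b')}{\delta(a,b')\delta(b,a')}$.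 *)

theory Defs
  imports "HOL-Analysis.Analysis"
begin

section \<open>Kernels of hyperbolic type and coarse strong hyperbolicity\<close>

definition kernel :: "('a::topological_space \<Rightarrow> 'a \<Rightarrow> real) \<Rightarrow> bool" where
  "kernel K \<longleftrightarrow> continuous_on UNIV (\<lambda>(x, y). K x y) \<and> (\<forall>x y. K x y = K y x)"

definition kernel_of_hyperbolic_type :: "('a::topological_space \<Rightarrow> 'a \<Rightarrow> real) \<Rightarrow> bool" where
  "kernel_of_hyperbolic_type K \<longleftrightarrow>
     kernel K \<and> (\<forall>x y. 0 \<le> K x y) \<and> (\<forall>x. K x x = 1) \<and>
     (\<forall>(n::nat) (x :: nat \<Rightarrow> 'a) (l :: nat \<Rightarrow> real).
        (\<Sum>i=1..n. \<Sum>j=1..n. l i * l j * K (x i) (x j)) \<le> (\<Sum>k=1..n. l k * K (x 0) (x k))\<^sup>2)"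

definition coarsely_strongly_hyperbolic :: "'a::metric_space itself \<Rightarrow> real \<Rightarrow> real \<Rightarrow> bool" where
  "coarsely_strongly_hyperbolic _ C \<epsilon> \<longleftrightarrow>
     (\<forall>x1 x2 x3 x4 :: 'a.
        exp (\<epsilon> / 2 * (dist x1 x3 + dist x2 x4))
          \<le> exp (\<epsilon> / 2 * (dist x1 x2 + dist x3 x4)) + exp (\<epsilon> / 2 * (dist x1 x4 + dist x2 x3))
            + C * exp (\<epsilon> / 2 * Max ((\<lambda>(p, q). dist p q) ` ({x1, x2, x3, x4} \<times> {x1, x2, x3, x4}))))"

section \<open>Gromov product, Gromov hyperbolicity, Gromov boundary\<close>

definition gromov_product :: "'a::metric_space \<Rightarrow> 'a \<Rightarrow> 'a \<Rightarrow> real" where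
  "gromov_product w x y = (dist w x + dist w y - dist x y) / 2"

text \<open>No geodesics are assumed, so hyperbolicity is expressed by the Gromov product inequality.\<close>

definition gromov_hyperbolic :: "'a::metric_space itself \<Rightarrow> bool" where
  "gromov_hyperbolic _ \<longleftrightarrow>
     (\<exists>\<delta>. \<forall>w x y z :: 'a.
        min (gromov_product w x y) (gromov_product w y z) - \<delta> \<le> gromov_product w x z)"

text \<open>For \<open>u\<close> and \<open>v\<close>: the product of \<open>u i\<close> and \<open>v j\<close> tends to
  infinity as \<open>i\<close> and \<open>j\<close> do so independently. Changing the base point alters the
  product by a bounded amount, so quantifying over all base points is harmless.\<close>

definition gromov_equivalent :: "(nat \<Rightarrow> 'a::metric_space) \<Rightarrow> (nat \<Rightarrow> 'a) \<Rightarrow> bool" where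
  "gromov_equivalent u v \<longleftrightarrow>
     (\<forall>w. filterlim (\<lambda>(i, j). gromov_product w (u i) (v j)) at_top (sequentially \<times>\<^sub>F sequentially))"

definition gromov_sequences :: "(nat \<Rightarrow> 'a::metric_space) set" where
  "gromov_sequences = {u. gromov_equivalent u u}"

definition gromov_boundary :: "(nat \<Rightarrow> 'a::metric_space) set set" where
  "gromov_boundary =
     gromov_sequences // {(u, v). u \<in> gromov_sequences \<and> v \<in> gromov_sequences \<and> gromov_equivalent u v}"

text \<open>The union of the space with its boundary. Points of the space are tagged by \<open>Inl\<close>,
  boundary points by \<open>Inr\<close>.\<close>

type_synonym 'a bord = "'a + (nat \<Rightarrow> 'a) set"

definition bordification :: "'a::metric_space bord set" where
  "bordification = range Inl \<union> Inr ` gromov_boundary"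

text \<open>Sequences representing a point; a point of the space is represented by the constant
  sequence.\<close>

fun representatives :: "'a bord \<Rightarrow> (nat \<Rightarrow> 'a) set" where
  "representatives (Inl x) = {\<lambda>_. x}"
| "representatives (Inr A) = A"

text \<open>The usual extension of the Gromov product to boundary points, meaningful in any Gromov
  hyperbolic space: the infimum over representing sequences of the lower limit. In general it need
  not be continuous. The value is infinite when both arguments are the same boundary point.\<close>

definition gromov_product_ext :: "'a::metric_space \<Rightarrow> 'a bord \<Rightarrow> 'a bord \<Rightarrow> ereal" where
  "gromov_product_ext w p q =
     (INF u \<in> representatives p. INF v \<in> representatives q.
        Liminf (sequentially \<times>\<^sub>F sequentially) (\<lambda>(i, j). ereal (gromov_product w (u i) (v j))))"

text \<open>The standard topology on the bordification: the space is an open subspace with its metric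
  topology, and a boundary point \<open>\<xi>\<close> has the sets of \<open>p\<close> whose product with
  \<open>\<xi>\<close> exceeds \<open>t\<close> as basic neighbourhoods.\<close>

definition bord_open :: "'a::metric_space bord set \<Rightarrow> bool" where
  "bord_open U \<longleftrightarrow>
     U \<subseteq> bordification \<and> open (Inl -` U) \<and>
     (\<forall>\<xi>\<in>gromov_boundary. Inr \<xi> \<in> U \<longrightarrow>
        (\<forall>w. \<exists>t::real. {p \<in> bordification. ereal t < gromov_product_ext w p (Inr \<xi>)} \<subseteq> U))"

definition bord_topology :: "'a::metric_space bord topology" where
  "bord_topology = topology bord_open"

lemma istopology_bord_open: "istopology (bord_open :: 'a::metric_space bord set \<Rightarrow> bool)"
  unfolding istopology_def
proof (intro conjI allI impI)
  fix S T :: "'a bord set"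
  assume S: "bord_open S" and T: "bord_open T"
  show "bord_open (S \<inter> T)"
    unfolding bord_open_def
  proof (intro conjI ballI impI allI)
    show "S \<inter> T \<subseteq> bordification" using S by (auto simp: bord_open_def)
    show "open (Inl -` (S \<inter> T))" using S T by (auto simp: bord_open_def)
  next
    fix \<xi> :: "(nat \<Rightarrow> 'a) set" and w :: 'a
    assume \<xi>: "\<xi> \<in> gromov_boundary" "Inr \<xi> \<in> S \<inter> T"
    obtain s where s: "{p \<in> bordification. ereal s < gromov_product_ext w p (Inr \<xi>)} \<subseteq> S"
      using S \<xi> unfolding bord_open_def by blast
    obtain t where t: "{p \<in> bordification. ereal t < gromov_product_ext w p (Inr \<xi>)} \<subseteq> T"
      using T \<xi> unfolding bord_open_def by blast
    have "ereal s < g \<and> ereal t < g" if "ereal (max s t) < g" for g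
      using that by (cases g) auto
    then show "\<exists>t. {p \<in> bordification. ereal t < gromov_product_ext w p (Inr \<xi>)} \<subseteq> S \<inter> T"
      using s t by (intro exI[of _ "max s t"]) blast
  qed
next
  fix \<U> :: "'a bord set set"
  assume U: "\<forall>S\<in>\<U>. bord_open S"
  show "bord_open (\<Union>\<U>)"
    unfolding bord_open_def
  proof (intro conjI ballI impI allI)
    show "\<Union>\<U> \<subseteq> bordification" using U by (auto simp: bord_open_def)
    show "open (Inl -` \<Union>\<U>)" using U by (auto simp: bord_open_def vimage_Union)
  next
    fix \<xi> :: "(nat \<Rightarrow> 'a) set" and w :: 'a
    assume \<xi>: "\<xi> \<in> gromov_boundary" "Inr \<xi> \<in> \<Union>\<U>"
    then obtain S where S: "S \<in> \<U>" "Inr \<xi> \<in> S" by blast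
    then obtain t where "{p \<in> bordification. ereal t < gromov_product_ext w p (Inr \<xi>)} \<subseteq> S"
      using U \<xi> unfolding bord_open_def by blast
    then show "\<exists>t. {p \<in> bordification. ereal t < gromov_product_ext w p (Inr \<xi>)} \<subseteq> \<Union>\<U>"
      using S by blast
  qed
qed

lemma openin_bord_topology: "openin bord_topology U \<longleftrightarrow> bord_open U"
  unfolding bord_topology_def by (simp add: topology_inverse'[OF istopology_bord_open])

lemma topspace_bord_topology: "topspace bord_topology = bordification"
proof
  show "topspace bord_topology \<subseteq> (bordification :: 'a bord set)"
    unfolding topspace_def by (auto simp: openin_bord_topology bord_open_def)
  have "Inl -` bordification = (UNIV :: 'a set)" by (auto simp: bordification_def)
  then have "bord_open (bordification :: 'a bord set)" by (auto simp: bord_open_def)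
  then show "(bordification :: 'a bord set) \<subseteq> topspace bord_topology"
    by (simp add: openin_bord_topology openin_subset)
qed

section \<open>Visual metametrics and cross-ratios\<close>

text \<open>The extension of \<open>exp (- \<epsilon> * gromov_product w x y)\<close> to the bordification, with
  value 0 where the Gromov product is infinite.\<close>

definition visual_metametric :: "real \<Rightarrow> 'a::metric_space \<Rightarrow> 'a bord \<Rightarrow> 'a bord \<Rightarrow> real" where
  "visual_metametric \<epsilon> w p q =
     (if gromov_product_ext w p q = \<infinity> then 0
      else exp (- \<epsilon> * real_of_ereal (gromov_product_ext w p q)))"

definition metric_cross_ratio :: "('b \<Rightarrow> 'b \<Rightarrow> real) \<Rightarrow> 'b \<Rightarrow> 'b \<Rightarrow> 'b \<Rightarrow> 'b \<Rightarrow> real" where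
  "metric_cross_ratio \<rho> a a' b b' = (\<rho> a a' * \<rho> b b') / (\<rho> a b' * \<rho> b a')"

text \<open>The inequalities exclude exactly the quadruples for which the denominator vanishes.\<close>

definition moebius_equivalent_on :: "'b set \<Rightarrow> ('b \<Rightarrow> 'b \<Rightarrow> real) \<Rightarrow> ('b \<Rightarrow> 'b \<Rightarrow> real) \<Rightarrow> bool" where
  "moebius_equivalent_on S \<rho> \<sigma> \<longleftrightarrow>
     (\<forall>a\<in>S. \<forall>a'\<in>S. \<forall>b\<in>S. \<forall>b'\<in>S. a \<noteq> b' \<and> b \<noteq> a' \<longrightarrow>
        metric_cross_ratio \<rho> a a' b b' = metric_cross_ratio \<sigma> a a' b b')"

end

theory Submission
  imports Defs
begin

text \<open>Write \<open>K = exp (\<epsilon> d)\<close>. The defining inequality says that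
  \<open>K x w * K y w - K x y\<close> is positive semidefinite for every base point \<open>w\<close>. Applied to
  weights with \<open>\<Sum> l\<^sub>i (K x\<^sub>i w - 1) = 0\<close> it gives Ptolemy's inequality for
  \<open>sqrt (K - 1)\<close>, and \<open>sqrt K \<le> sqrt (K - 1) + 1\<close> turns this into coarse strong
  hyperbolicity. Dividing by \<open>K x w * K y w\<close> instead shows that
  \<open>g x y = exp (- \<epsilon> (x | y)\<^sub>w)\<close> satisfies
  \<open>g x y ^ 2 = h x y ^ 2 + (g x x ^ 2 + g y y ^ 2) / 2\<close> for a pseudometric \<open>h\<close> on the space.
  Gromov sequences are exactly the \<open>h\<close>-Cauchy sequences with \<open>g x x \<longlonglongrightarrow> 0\<close>,
  hence \<open>g\<close> extends continuously to the boundary and coincides with \<open>h\<close> there. Cross-ratios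
  of \<open>g\<close> on the space do not depend on \<open>w\<close>, and this passes to the limit.\<close>

text \<open>Three squared distances of negative type come from points of a Euclidean space, hence a
  triangle inequality. Directly: were the inequality to fail, weights proportional to the sides of a
  degenerate triangle would make the form positive.\<close>

lemma triangle_of_negative_type:
  fixes a b c :: real
  assumes "0 \<le> a" "0 \<le> b"
    and neg: "\<And>x y z. x + y + z = 0 \<Longrightarrow> x * y * a\<^sup>2 + y * z * b\<^sup>2 + x * z * c\<^sup>2 \<le> 0"
  shows "c \<le> a + b"
proof (rule ccontr)
  assume "\<not> c \<le> a + b"
  \<comment> \<open>Half of the excess goes to each side. Then \<open>c = a' + b'\<close>, so the
    weights \<open>b'\<close>, \<open>- c\<close>, \<open>a'\<close> sum to zero, and both new sides
    are positive even if \<open>a\<close> or \<open>b\<close> is 0.\<close>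
  define a' where "a' = a + (c - a - b) / 2"
  define b' where "b' = b + (c - a - b) / 2"
  have a': "a < a'" and b': "b < b'" and c: "c = a' + b'"
    using \<open>\<not> c \<le> a + b\<close> by (simp_all add: a'_def b'_def field_simps)
  have "b' * (- c) * a\<^sup>2 + (- c) * a' * b\<^sup>2 + b' * a' * c\<^sup>2 \<le> 0"
    by (rule neg) (simp add: c)
  then have "c * (a' * b' * c - b' * a\<^sup>2 - a' * b\<^sup>2) \<le> 0"
    by (simp add: algebra_simps power2_eq_square)
  moreover have "b' * a\<^sup>2 < b' * a'\<^sup>2"
    using a' b' assms(1,2) by (intro mult_strict_left_mono power_strict_mono) auto
  moreover have "a' * b\<^sup>2 < a' * b'\<^sup>2"
    using a' b' assms(1,2) by (intro mult_strict_left_mono power_strict_mono) auto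
  moreover have "a' * b' * c = b' * a'\<^sup>2 + a' * b'\<^sup>2"
    by (simp add: c algebra_simps power2_eq_square)
  moreover have "0 < c" using a' b' assms(1,2) c by linarith
  ultimately show False
    by (smt (verit) mult_pos_pos)
qed

section \<open>Double limits; symmetry and base-point change of the Gromov product\<close>

lemma tendsto_prod_sequentially_diagonal:
  assumes "((\<lambda>(i, j). f i j) \<longlongrightarrow> l) (sequentially \<times>\<^sub>F sequentially)"
  shows "(\<lambda>i. f i i) \<longlonglongrightarrow> l"
  using filterlim_compose[OF assms filterlim_Pair[OF filterlim_ident filterlim_ident]] by simp

lemma tendsto_0_sandwich_prod:
  fixes f g :: "'b \<Rightarrow> 'c \<Rightarrow> real"
  assumes "((\<lambda>(i, j). g i j) \<longlongrightarrow> 0) F" "\<And>i j. 0 \<le> f i j" "\<And>i j. f i j \<le> g i j"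
  shows "((\<lambda>(i, j). f i j) \<longlongrightarrow> 0) F"
  by (rule tendsto_sandwich[OF always_eventually always_eventually tendsto_const assms(1)])
     (use assms in auto)

lemma gromov_product_commute: "gromov_product w x y = gromov_product w y x"
  by (simp add: gromov_product_def dist_commute)

lemma gromov_product_change_base:
  "gromov_product w x y \<le> gromov_product w' x y + dist w w'"
  using dist_triangle[of w x w'] dist_triangle[of w y w']
  by (simp add: gromov_product_def field_simps)

lemma gromov_product_ext_commute: "gromov_product_ext w p q = gromov_product_ext w q p"
proof -
  have swap: "Liminf (sequentially \<times>\<^sub>F sequentially) (\<lambda>(i, j). ereal (gromov_product w (u i) (v j)))
      = Liminf (sequentially \<times>\<^sub>F sequentially) (\<lambda>(i, j). ereal (gromov_product w (v i) (u j)))"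
    for u v :: "nat \<Rightarrow> 'a"
    by (subst prod_filter_commute)
       (simp add: Liminf_filtermap_eq case_prod_unfold prod.swap_def gromov_product_commute[of w "u _"])
  show ?thesis
    unfolding gromov_product_ext_def by (subst INF_commute) (intro INF_cong refl swap)
qed

lemma gromov_product_ext_Inl_Inl:
  "gromov_product_ext w (Inl x) (Inl y) = ereal (gromov_product w x y)"
  by (simp add: gromov_product_ext_def case_prod_unfold Liminf_const prod_filter_eq_bot)

lemma visual_metametric_commute: "visual_metametric \<epsilon> w p q = visual_metametric \<epsilon> w q p"
  by (simp add: visual_metametric_def gromov_product_ext_commute[of w p q])

lemma visual_metametric_nonneg: "0 \<le> visual_metametric \<epsilon> w p q"
  by (simp add: visual_metametric_def)

locale exp_dist_hyperbolic_type =
  fixes \<epsilon> :: real and X :: "'a::metric_space itself"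
  assumes pos: "0 < \<epsilon>"
    and hyperbolic_type: "kernel_of_hyperbolic_type (\<lambda>x y :: 'a. exp (\<epsilon> * dist x y))"
begin

text \<open>The case of three points and base point \<open>w\<close> of the defining inequality,
  with the diagonal entries evaluated to 1. The hyperbolic-type hypothesis enters all later
  arguments through it.\<close>

lemma three_points:
  fixes w x y z :: 'a
  shows "a\<^sup>2 + b\<^sup>2 + c\<^sup>2 + 2 * (a * b * exp (\<epsilon> * dist x y) + b * c * exp (\<epsilon> * dist y z)
      + a * c * exp (\<epsilon> * dist x z))
    \<le> (a * exp (\<epsilon> * dist w x) + b * exp (\<epsilon> * dist w y) + c * exp (\<epsilon> * dist w z))\<^sup>2"
proof -
  \<comment> \<open>Index 3 takes the default values \<open>z\<close> and \<open>c\<close>; index 0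
    of \<open>?x\<close> is the base point.\<close>
  let ?x = "(\<lambda>_::nat. z)(0 := w, 1 := x, 2 := y)" and ?l = "(\<lambda>_::nat. c)(1 := a, 2 := b)"
  have "(\<Sum>i=1..3. \<Sum>j=1..3. ?l i * ?l j * exp (\<epsilon> * dist (?x i) (?x j)))
      \<le> (\<Sum>k=1..3. ?l k * exp (\<epsilon> * dist (?x 0) (?x k)))\<^sup>2"
    using hyperbolic_type unfolding kernel_of_hyperbolic_type_def by blast
  moreover have "{1..3} = {1, 2, 3::nat}" by auto
  ultimately show ?thesis
    by (simp add: dist_commute algebra_simps power2_eq_square)
qed

subsection \<open>Ptolemy's inequality\<close>

text \<open>If \<open>exp (\<epsilon> * dist x y)\<close> is written as cosh r with a hyperbolic
  distance r, this is sqrt 2 times sinh (r / 2), the quantity for which Ptolemy's inequality holds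
  in hyperbolic space.\<close>

definition half_chord :: "'a \<Rightarrow> 'a \<Rightarrow> real" where
  "half_chord x y = sqrt (exp (\<epsilon> * dist x y) - 1)"

lemma half_chord_nonneg: "0 \<le> half_chord x y"
  using pos by (simp add: half_chord_def)

lemma half_chord_commute: "half_chord x y = half_chord y x"
  by (simp add: half_chord_def dist_commute)

lemma half_chord_eq_0_iff: "half_chord x y = 0 \<longleftrightarrow> x = y"
  using pos by (simp add: half_chord_def)

lemma exp_eq_half_chord: "exp (\<epsilon> * dist x y) = (half_chord x y)\<^sup>2 + 1"
  using pos by (simp add: half_chord_def)

text \<open>After inversion at \<open>w\<close>, this is a triangle inequality between
  \<open>x\<close>, \<open>y\<close>, \<open>z\<close>. If one of them equals \<open>w\<close>,
  inversion makes no sense, but the inequality is immediate.\<close>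

lemma ptolemy:
  "half_chord x z * half_chord y w \<le> half_chord x y * half_chord z w + half_chord y z * half_chord x w"
proof (cases "x = w \<or> y = w \<or> z = w")
  case True
  then show ?thesis
    using half_chord_nonneg by (auto simp: half_chord_commute half_chord_eq_0_iff[THEN iffD2])
next
  case False
  show ?thesis
  proof (rule triangle_of_negative_type)
    fix l m n :: real
    assume lmn: "l + m + n = 0"
    let ?P = "(half_chord w x * half_chord w y * half_chord w z)\<^sup>2"
    \<comment> \<open>Up to the common factor \<open>?P\<close>, the weights are \<open>l\<close>,
      \<open>m\<close>, \<open>n\<close> divided by the squared half chords to \<open>w\<close>;
      this turns \<open>l + m + n = 0\<close> into the condition needed at the base point.\<close>
    define a where "a = l * (half_chord w y)\<^sup>2 * (half_chord w z)\<^sup>2"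
    define b where "b = m * (half_chord w x)\<^sup>2 * (half_chord w z)\<^sup>2"
    define c where "c = n * (half_chord w x)\<^sup>2 * (half_chord w y)\<^sup>2"
    have "a * (half_chord w x)\<^sup>2 + b * (half_chord w y)\<^sup>2 + c * (half_chord w z)\<^sup>2 = ?P * (l + m + n)"
      by (simp add: a_def b_def c_def algebra_simps)
    also have "\<dots> = 0" by (simp only: lmn mult_zero_right)
    finally have "a * exp (\<epsilon> * dist w x) + b * exp (\<epsilon> * dist w y) + c * exp (\<epsilon> * dist w z) = a + b + c"
      by (simp add: exp_eq_half_chord algebra_simps)
    \<comment> \<open>The base side of \<open>three_points\<close> is now the square of
      \<open>a + b + c\<close>, which cancels the diagonal terms and the summands 1 of
      \<open>exp_eq_half_chord\<close>.\<close>
    then have "a * b * (half_chord x y)\<^sup>2 + b * c * (half_chord y z)\<^sup>2 + a * c * (half_chord x z)\<^sup>2 \<le> 0"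
      using three_points[of a b c x y z w]
      by (simp add: exp_eq_half_chord algebra_simps power2_eq_square)
    also have "a * b * (half_chord x y)\<^sup>2 + b * c * (half_chord y z)\<^sup>2 + a * c * (half_chord x z)\<^sup>2
      = ?P * (l * m * (half_chord x y * half_chord z w)\<^sup>2 + m * n * (half_chord y z * half_chord x w)\<^sup>2
          + l * n * (half_chord x z * half_chord y w)\<^sup>2)"
      by (simp add: a_def b_def c_def half_chord_commute[of _ w] algebra_simps power2_eq_square)
    finally show "l * m * (half_chord x y * half_chord z w)\<^sup>2 + m * n * (half_chord y z * half_chord x w)\<^sup>2
          + l * n * (half_chord x z * half_chord y w)\<^sup>2 \<le> 0"
      using False by (simp add: mult_le_0_iff half_chord_eq_0_iff)
        (smt (verit) half_chord_eq_0_iff mult_eq_0_iff power2_less_0 zero_less_power2)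
  qed (simp_all add: half_chord_nonneg)
qed

lemma half_chord_bounds:
  "half_chord x y \<le> exp (\<epsilon> / 2 * dist x y)" "exp (\<epsilon> / 2 * dist x y) \<le> half_chord x y + 1"
proof -
  have e: "exp (\<epsilon> / 2 * dist x y) = sqrt ((half_chord x y)\<^sup>2 + 1)"
    unfolding exp_eq_half_chord[symmetric]
    by (rule real_sqrt_unique[symmetric]) (simp_all add: power2_eq_square flip: exp_add)
  show "half_chord x y \<le> exp (\<epsilon> / 2 * dist x y)"
    unfolding e by (rule real_le_rsqrt) simp
  show "exp (\<epsilon> / 2 * dist x y) \<le> half_chord x y + 1"
    unfolding e using half_chord_nonneg[of x y] by (intro real_le_lsqrt) (auto simp: power2_eq_square algebra_simps)
qed

text \<open>By \<open>half_chord_bounds\<close> each exponential exceeds its half chord by at most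
  1. Replacing the two factors on the left one after the other costs one single exponential
  each.\<close>

lemma coarse_ptolemy:
  fixes x y z w :: 'a
  shows
  "exp (\<epsilon> / 2 * (dist x z + dist y w)) \<le>
     exp (\<epsilon> / 2 * (dist x y + dist z w)) + exp (\<epsilon> / 2 * (dist x w + dist y z))
     + (exp (\<epsilon> / 2 * dist x z) + exp (\<epsilon> / 2 * dist y w))"
proof -
  define e where "e p q = exp (\<epsilon> / 2 * dist p q)" for p q :: 'a
  have sum: "exp (\<epsilon> / 2 * (dist p q + dist r s)) = e p q * e r s" for p q r s
    by (simp add: e_def distrib_left exp_add)
  have le: "half_chord p q \<le> e p q" "e p q \<le> half_chord p q + 1" for p q
    using half_chord_bounds by (simp_all add: e_def)
  have e0: "0 \<le> e p q" for p q by (simp add: e_def)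
  have "e x z * e y w \<le> e x z * (half_chord y w + 1)"
    by (intro mult_left_mono le e0)
  also have "\<dots> \<le> (half_chord x z + 1) * half_chord y w + e x z"
    using mult_right_mono[OF le(2)[of x z] half_chord_nonneg[of y w]] by (simp add: algebra_simps)
  also have "\<dots> \<le> half_chord x z * half_chord y w + (e x z + e y w)"
    using le(1)[of y w] by (simp add: algebra_simps)
  also have "\<dots> \<le> e x y * e z w + e x w * e y z + (e x z + e y w)"
  proof -
    have "half_chord x y * half_chord z w \<le> e x y * e z w" "half_chord y z * half_chord x w \<le> e y z * e x w"
      by (intro mult_mono le e0 half_chord_nonneg)+
    then show ?thesis using ptolemy[of x z y w] by (simp add: mult.commute)
  qed
  finally show ?thesis unfolding sum unfolding e_def .
qed

text \<open>Each of the two error terms of \<open>coarse_ptolemy\<close> is at most the exponential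
  of the largest distance, so their sum stays below three times it.\<close>

lemma coarsely_strongly_hyperbolic: "coarsely_strongly_hyperbolic X 3 \<epsilon>"
  unfolding coarsely_strongly_hyperbolic_def
proof (intro allI)
  fix x1 x2 x3 x4 :: 'a
  define m where "m = Max ((\<lambda>(p, q). dist p q) ` ({x1, x2, x3, x4} \<times> {x1, x2, x3, x4}))"
  have "dist p q \<le> m" if "p \<in> {x1, x2, x3, x4}" "q \<in> {x1, x2, x3, x4}" for p q
    unfolding m_def by (rule Max_ge) (use that in \<open>auto intro!: rev_image_eqI[of "(p, q)"]\<close>)
  then have "dist x1 x3 \<le> m" "dist x2 x4 \<le> m" by simp_all
  then have "exp (\<epsilon> / 2 * dist x1 x3) \<le> exp (\<epsilon> / 2 * m)" "exp (\<epsilon> / 2 * dist x2 x4) \<le> exp (\<epsilon> / 2 * m)"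
    using pos by simp_all
  then show "exp (\<epsilon> / 2 * (dist x1 x3 + dist x2 x4))
        \<le> exp (\<epsilon> / 2 * (dist x1 x2 + dist x3 x4)) + exp (\<epsilon> / 2 * (dist x1 x4 + dist x2 x3))
          + 3 * exp (\<epsilon> / 2 * Max ((\<lambda>(p, q). dist p q) ` ({x1, x2, x3, x4} \<times> {x1, x2, x3, x4})))"
    unfolding m_def[symmetric]
    using coarse_ptolemy[of x1 x3 x2 x4] exp_gt_zero[of "\<epsilon> / 2 * m"] by linarith
qed

text \<open>Each diagonal of a quadrilateral is at most half its perimeter, so the error term of
  the coarse Ptolemy inequality is absorbed by the larger of the two products.\<close>

lemma gromov_hyperbolic: "gromov_hyperbolic X"
  unfolding gromov_hyperbolic_def
proof (intro exI allI)
  fix w x y z :: 'a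
  define m where "m = max (dist x y + dist z w) (dist x w + dist y z)"
  have "dist x z \<le> m" "dist y w \<le> m"
    using dist_triangle[of x z y] dist_triangle[of x z w] dist_triangle[of y w x] dist_triangle[of y w z]
    by (auto simp: m_def max_def dist_commute)
  then have "exp (\<epsilon> / 2 * dist x z) \<le> exp (\<epsilon> / 2 * m)" "exp (\<epsilon> / 2 * dist y w) \<le> exp (\<epsilon> / 2 * m)"
    "exp (\<epsilon> / 2 * (dist x y + dist z w)) \<le> exp (\<epsilon> / 2 * m)"
    "exp (\<epsilon> / 2 * (dist x w + dist y z)) \<le> exp (\<epsilon> / 2 * m)"
    using pos by (auto simp: m_def)
  \<comment> \<open>Two products and two error terms give the factor 4. Its logarithm, scaled by
    \<open>2 / \<epsilon>\<close> and halved in the Gromov product, is the hyperbolicity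
    constant.\<close>
  then have "exp (\<epsilon> / 2 * (dist x z + dist y w)) \<le> 4 * exp (\<epsilon> / 2 * m)"
    using coarse_ptolemy[of x z y w] by linarith
  also have "\<dots> = exp (ln 4 + \<epsilon> / 2 * m)" by (simp add: exp_add)
  finally have "dist x z + dist y w \<le> m + 2 * ln 4 / \<epsilon>"
    using pos by (simp add: field_simps)
  then show "min (gromov_product w x y) (gromov_product w y z) - ln 4 / \<epsilon> \<le> gromov_product w x z"
    by (auto simp: gromov_product_def m_def min_def max_def dist_commute field_simps split: if_splits)
qed

subsection \<open>The chordal pseudometric\<close>

definition visual :: "'a \<Rightarrow> 'a \<Rightarrow> 'a \<Rightarrow> real" where
  "visual w x y = exp (- \<epsilon> * gromov_product w x y)"

text \<open>The Euclidean distance in the Klein ball centred at \<open>w\<close>, divided by sqrt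
  2.\<close>

definition chordal :: "'a \<Rightarrow> 'a \<Rightarrow> 'a \<Rightarrow> real" where
  "chordal w x y = sqrt ((visual w x y)\<^sup>2 - ((visual w x x)\<^sup>2 + (visual w y y)\<^sup>2) / 2)"

lemma visual_commute: "visual w x y = visual w y x"
  by (simp add: visual_def gromov_product_commute[of w x y])

lemma visual_pos: "0 < visual w x y"
  by (simp add: visual_def)

lemma chordal_commute: "chordal w x y = chordal w y x"
  by (simp add: chordal_def visual_commute[of w x y] add.commute)

lemma chordal_self: "chordal w x x = 0"
  by (simp add: chordal_def)

text \<open>In the vector space model with base point \<open>w\<close>, the function
  \<open>1 - (visual w x y)\<^sup>2\<close> is the inner product of the points of the Klein ball
  representing \<open>x\<close> and \<open>y\<close>.\<close>

lemma visual_negative_type: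
  assumes "l + m + n = 0"
  shows "(l * visual w x x)\<^sup>2 + (m * visual w y y)\<^sup>2 + (n * visual w z z)\<^sup>2
    + 2 * (l * m * (visual w x y)\<^sup>2 + m * n * (visual w y z)\<^sup>2 + l * n * (visual w x z)\<^sup>2) \<le> 0"
proof -
  have vis: "exp (- \<epsilon> * dist w p) * exp (- \<epsilon> * dist w q) * exp (\<epsilon> * dist p q) = (visual w p q)\<^sup>2" for p q
    by (simp add: visual_def gromov_product_def power2_eq_square field_simps flip: exp_add)
  have self: "exp (- \<epsilon> * dist w p) = visual w p p" for p
    by (simp add: visual_def gromov_product_def)
  have *: "l * m * (visual w p q)\<^sup>2 =
      (l * exp (- \<epsilon> * dist w p)) * (m * exp (- \<epsilon> * dist w q)) * exp (\<epsilon> * dist p q)" for l m p q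
    unfolding vis[symmetric] by (simp only: mult_ac)
  \<comment> \<open>The rescaled weights reduce each base term to \<open>l\<close>, \<open>m\<close>
    or \<open>n\<close>, so the right side of \<open>three_points\<close> vanishes.\<close>
  have "l * exp (- \<epsilon> * dist w x) * exp (\<epsilon> * dist w x) + m * exp (- \<epsilon> * dist w y) * exp (\<epsilon> * dist w y)
      + n * exp (- \<epsilon> * dist w z) * exp (\<epsilon> * dist w z) = 0"
    using assms by (simp add: mult.assoc flip: exp_add)
  then show ?thesis
    using three_points[of "l * exp (- \<epsilon> * dist w x)" "m * exp (- \<epsilon> * dist w y)"
        "n * exp (- \<epsilon> * dist w z)" x y z w]
    unfolding * self by simp
qed

text \<open>The weights 1, -1, 0 show that the radicand is nonnegative.\<close>

lemma chordal_square:
  "(chordal w x y)\<^sup>2 = (visual w x y)\<^sup>2 - ((visual w x x)\<^sup>2 + (visual w y y)\<^sup>2) / 2"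
  using visual_negative_type[of 1 "-1" 0 w x y x] by (simp add: chordal_def)

lemma chordal_nonneg: "0 \<le> chordal w x y"
  using visual_negative_type[of 1 "-1" 0 w x y x] by (simp add: chordal_def)

text \<open>Since \<open>l + m + n = 0\<close>, the diagonal parts of \<open>chordal_square\<close>
  add up to half of the squares in \<open>visual_negative_type\<close>, so the required form is half
  of the one there.\<close>

lemma chordal_triangle: "chordal w x z \<le> chordal w x y + chordal w y z"
proof (rule triangle_of_negative_type)
  fix l m n :: real
  assume lmn: "l + m + n = 0"
  then have n: "n = - l - m" by simp
  show "l * m * (chordal w x y)\<^sup>2 + m * n * (chordal w y z)\<^sup>2 + l * n * (chordal w x z)\<^sup>2 \<le> 0"
    using visual_negative_type[OF lmn, of w x y z]
    unfolding chordal_square n by (simp add: field_simps power2_eq_square)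
qed (simp_all add: chordal_nonneg)

lemma chordal_diff:
  "\<bar>chordal w x y - chordal w x' y'\<bar> \<le> chordal w x x' + chordal w y y'"
  using chordal_triangle[of w x y x'] chordal_triangle[of w x' y y']
    chordal_triangle[of w x' y' x] chordal_triangle[of w x y' y]
  by (simp add: chordal_commute[of w y' y] chordal_commute[of w x' x])

lemma visual_eq: "visual w x y = sqrt ((chordal w x y)\<^sup>2 + ((visual w x x)\<^sup>2 + (visual w y y)\<^sup>2) / 2)"
  using visual_pos[of w x y] by (simp add: chordal_square)

lemma chordal_le_visual: "chordal w x y \<le> visual w x y"
  unfolding visual_eq[of w x y] by (rule real_le_rsqrt) simp

text \<open>Follows from the squared chordal distance being nonnegative. It forces points close to a
  boundary point to be far from \<open>w\<close>.\<close>

lemma visual_self_le: "visual w x x \<le> sqrt 2 * visual w x y"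
proof -
  have "(visual w x x)\<^sup>2 \<le> 2 * (visual w x y)\<^sup>2"
  proof -
    have "a \<le> 2 * v" if "c = v - (a + b) / 2" "0 \<le> c" "0 \<le> b" for a b c v :: real
      using that by (simp add: field_simps)
    from this[OF chordal_square] show ?thesis by simp
  qed
  from real_le_rsqrt[OF this] show ?thesis using visual_pos[of w x y] by (simp add: real_sqrt_mult)
qed

lemma visual_change_base: "visual w x y \<le> exp (\<epsilon> * dist w w') * visual w' x y"
proof -
  have "\<epsilon> * gromov_product w' x y \<le> \<epsilon> * (gromov_product w x y + dist w w')"
    using gromov_product_change_base[of w' x y w] pos by (intro mult_left_mono) (auto simp: dist_commute)
  then show ?thesis by (simp add: visual_def algebra_simps flip: exp_add)
qed

subsection \<open>Sequences converging to infinity\<close>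

lemma gromov_equivalent_iff:
  "gromov_equivalent u v \<longleftrightarrow>
     (\<forall>w. ((\<lambda>(i, j). visual w (u i) (v j)) \<longlongrightarrow> 0) (sequentially \<times>\<^sub>F sequentially))"
proof -
  have "filterlim f at_top F \<longleftrightarrow> ((\<lambda>x. exp (- \<epsilon> * f x)) \<longlongrightarrow> 0) F"
    for f :: "nat \<times> nat \<Rightarrow> real" and F
  proof
    assume "filterlim f at_top F"
    from filterlim_tendsto_pos_mult_at_top[OF tendsto_const pos this]
    have "filterlim (\<lambda>x. \<epsilon> * f x) at_top F" .
    then have "filterlim (\<lambda>x. - \<epsilon> * f x) at_bot F"
      by (simp add: filterlim_uminus_at_bot)
    then show "((\<lambda>x. exp (- \<epsilon> * f x)) \<longlongrightarrow> 0) F"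
      by (rule filterlim_compose[OF exp_at_bot])
  next
    assume "((\<lambda>x. exp (- \<epsilon> * f x)) \<longlongrightarrow> 0) F"
    then have "filterlim (\<lambda>x. exp (- \<epsilon> * f x)) (at_right 0) F"
      by (simp add: filterlim_at)
    then have "filterlim (\<lambda>x. ln (exp (- \<epsilon> * f x))) at_bot F"
      by (rule filterlim_compose[OF ln_at_0])
    then have "filterlim (\<lambda>x. \<epsilon> * f x) at_top F"
      by (simp add: filterlim_uminus_at_bot)
    from filterlim_tendsto_pos_mult_at_top[OF tendsto_const[of "1 / \<epsilon>"] _ this]
    show "filterlim f at_top F" using pos by simp
  qed
  then show ?thesis by (simp add: gromov_equivalent_def visual_def case_prod_unfold)
qed

text \<open>One base point suffices, since a change of base costs only a constant factor.\<close>

lemma gromov_equivalentI: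
  assumes "((\<lambda>(i, j). visual w (u i) (v j)) \<longlongrightarrow> 0) (sequentially \<times>\<^sub>F sequentially)"
  shows "gromov_equivalent u v"
  unfolding gromov_equivalent_iff
proof
  fix w'
  show "((\<lambda>(i, j). visual w' (u i) (v j)) \<longlongrightarrow> 0) (sequentially \<times>\<^sub>F sequentially)"
  proof (rule tendsto_0_sandwich_prod)
    show "((\<lambda>(i, j). exp (\<epsilon> * dist w' w) * visual w (u i) (v j)) \<longlongrightarrow> 0) (sequentially \<times>\<^sub>F sequentially)"
      using tendsto_mult_right_zero[OF assms] by (simp add: case_prod_unfold)
  qed (auto simp: visual_change_base less_imp_le[OF visual_pos])
qed

lemma gromov_equivalent_chordal:
  assumes "gromov_equivalent u v"
  shows "((\<lambda>(i, j). chordal w (u i) (v j)) \<longlongrightarrow> 0) (sequentially \<times>\<^sub>F sequentially)"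
proof (rule tendsto_0_sandwich_prod)
  show "((\<lambda>(i, j). visual w (u i) (v j)) \<longlongrightarrow> 0) (sequentially \<times>\<^sub>F sequentially)"
    using assms by (simp add: gromov_equivalent_iff)
qed (simp_all add: chordal_le_visual chordal_nonneg)

lemma gromov_sequences_visual_self:
  assumes "u \<in> gromov_sequences"
  shows "(\<lambda>i. visual w (u i) (u i)) \<longlonglongrightarrow> 0"
  by (rule tendsto_prod_sequentially_diagonal) (use assms in \<open>simp add: gromov_sequences_def gromov_equivalent_iff\<close>)

text \<open>By \<open>visual_eq\<close>, \<open>visual\<close> is a continuous function of the
  chordal distance and the two diagonal values. This reduces its limits to those of a
  pseudometric.\<close>

lemma tendsto_visual:
  assumes "((\<lambda>(i, j). chordal w (u i) (v j)) \<longlongrightarrow> l) (sequentially \<times>\<^sub>F sequentially)"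
    and "(\<lambda>i. visual w (u i) (u i)) \<longlonglongrightarrow> a" "(\<lambda>i. visual w (v i) (v i)) \<longlonglongrightarrow> b"
  shows "((\<lambda>(i, j). visual w (u i) (v j)) \<longlongrightarrow> sqrt (l\<^sup>2 + (a\<^sup>2 + b\<^sup>2) / 2)) (sequentially \<times>\<^sub>F sequentially)"
proof -
  note lims = assms(1) filterlim_compose[OF assms(2) filterlim_fst]
    filterlim_compose[OF assms(3) filterlim_snd]
  show ?thesis
    unfolding case_prod_unfold visual_eq[of w "u _" "v _"]
    by (intro tendsto_intros lims[unfolded case_prod_unfold]) simp
qed

section \<open>The boundary as a quotient, and limits along representatives\<close>

definition boundary_rel :: "((nat \<Rightarrow> 'a) \<times> (nat \<Rightarrow> 'a)) set" where
  "boundary_rel = {(u, v). u \<in> gromov_sequences \<and> v \<in> gromov_sequences \<and> gromov_equivalent u v}"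

lemma gromov_boundary_eq: "gromov_boundary = gromov_sequences // boundary_rel"
  by (simp add: gromov_boundary_def boundary_rel_def)

text \<open>Transitivity is the substantial part: it is the chordal triangle inequality, carried
  back to \<open>visual\<close> by \<open>tendsto_visual\<close> because the diagonal values tend to
  0.\<close>

lemma equiv_boundary_rel: "equiv gromov_sequences boundary_rel"
proof (rule equivI)
  show "boundary_rel \<subseteq> gromov_sequences \<times> gromov_sequences"
    by (auto simp: boundary_rel_def)
  show "refl_on gromov_sequences boundary_rel"
    by (auto simp: refl_on_def boundary_rel_def gromov_sequences_def)
  show "sym boundary_rel"
  proof (rule symI)
    fix u v assume uv: "(u, v) \<in> boundary_rel"
    have "((\<lambda>(i, j). visual w (v i) (u j)) \<longlongrightarrow> 0) (sequentially \<times>\<^sub>F sequentially)" for w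
    proof -
      have "((\<lambda>(i, j). visual w (u i) (v j)) \<longlongrightarrow> 0) (sequentially \<times>\<^sub>F sequentially)"
        using uv by (auto simp: boundary_rel_def gromov_equivalent_iff)
      from filterlim_compose[OF this filterlim_Pair[OF filterlim_snd filterlim_fst]]
      show ?thesis by (simp add: case_prod_unfold visual_commute[of w "u _"])
    qed
    with uv show "(v, u) \<in> boundary_rel"
      by (auto simp: boundary_rel_def gromov_equivalent_iff)
  qed
  show "trans boundary_rel"
  proof (rule transI)
    fix u v t assume uv: "(u, v) \<in> boundary_rel" and vt: "(v, t) \<in> boundary_rel"
    have "((\<lambda>(i, j). visual w (u i) (t j)) \<longlongrightarrow> 0) (sequentially \<times>\<^sub>F sequentially)" for w
    proof -
      have 1: "((\<lambda>(i, j). chordal w (u i) (v j)) \<longlongrightarrow> 0) (sequentially \<times>\<^sub>F sequentially)"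
        using uv by (intro gromov_equivalent_chordal) (simp add: boundary_rel_def)
      have "((\<lambda>(i, j). chordal w (v i) (t j)) \<longlongrightarrow> 0) (sequentially \<times>\<^sub>F sequentially)"
        using vt by (intro gromov_equivalent_chordal) (simp add: boundary_rel_def)
      \<comment> \<open>The intermediate point is \<open>v j\<close>, with the same index as
        \<open>t j\<close>, so the second limit is needed along its diagonal only.\<close>
      then have 2: "((\<lambda>x. chordal w (v (snd x)) (t (snd x))) \<longlongrightarrow> 0) (sequentially \<times>\<^sub>F sequentially)"
        by (intro filterlim_compose[OF tendsto_prod_sequentially_diagonal filterlim_snd])
      have "((\<lambda>(i, j). chordal w (u i) (v j) + chordal w (v j) (t j)) \<longlongrightarrow> 0)
          (sequentially \<times>\<^sub>F sequentially)"
        using tendsto_add_zero[OF 1 2] by (simp add: case_prod_unfold)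
      then have "((\<lambda>(i, j). chordal w (u i) (t j)) \<longlongrightarrow> 0) (sequentially \<times>\<^sub>F sequentially)"
        by (rule tendsto_0_sandwich_prod) (auto simp: chordal_nonneg chordal_triangle)
      from tendsto_visual[OF this gromov_sequences_visual_self gromov_sequences_visual_self]
      show ?thesis using uv vt by (simp add: boundary_rel_def)
    qed
    with uv vt show "(u, t) \<in> boundary_rel"
      by (auto simp: boundary_rel_def gromov_equivalent_iff)
  qed
qed

lemma gromov_boundary_eq_iff:
  fixes \<xi> \<eta> :: "(nat \<Rightarrow> 'a) set"
  assumes "\<xi> \<in> gromov_boundary" "\<eta> \<in> gromov_boundary" "u \<in> \<xi>" "v \<in> \<eta>"
  shows "\<xi> = \<eta> \<longleftrightarrow> gromov_equivalent u v"
proof -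
  have "u \<in> gromov_sequences" "v \<in> gromov_sequences"
    using assms in_quotient_imp_subset[OF equiv_boundary_rel] unfolding gromov_boundary_eq by blast+
  then show ?thesis
    using quotient_eq_iff[OF equiv_boundary_rel assms[unfolded gromov_boundary_eq]]
    by (simp add: boundary_rel_def)
qed

lemma representatives_nonempty:
  fixes p :: "'a bord"
  assumes "p \<in> bordification"
  shows "representatives p \<noteq> {}"
proof (cases p)
  case (Inr \<xi>)
  then have "\<xi> \<in> gromov_sequences // boundary_rel"
    using assms by (auto simp: bordification_def gromov_boundary_eq)
  then show ?thesis
    using Inr in_quotient_imp_non_empty[OF equiv_boundary_rel] by simp
qed simp

text \<open>With \<open>u' = u\<close> this is the chordal Cauchy property of a
  representative.\<close>

lemma representatives_chordal:
  assumes "p \<in> bordification" "u \<in> representatives p" "u' \<in> representatives p"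
  shows "((\<lambda>(i, j). chordal w (u i) (u' j)) \<longlongrightarrow> 0) (sequentially \<times>\<^sub>F sequentially)"
proof (cases p)
  case (Inl x)
  then show ?thesis using assms by (simp add: chordal_self case_prod_unfold)
next
  case (Inr \<xi>)
  then show ?thesis
    using assms gromov_boundary_eq_iff[of \<xi> \<xi> u u']
    by (intro gromov_equivalent_chordal) (auto simp: bordification_def)
qed

lemma representatives_visual_self:
  assumes "p \<in> bordification"
  obtains a where "\<And>u. u \<in> representatives p \<Longrightarrow> (\<lambda>i. visual w (u i) (u i)) \<longlonglongrightarrow> a"
proof (cases p)
  case (Inl x)
  then show ?thesis using that[of "visual w x x"] by simp
next
  case (Inr \<xi>)
  then have "\<xi> \<subseteq> gromov_sequences"
    using assms in_quotient_imp_subset[OF equiv_boundary_rel]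
    by (auto simp: bordification_def gromov_boundary_eq)
  then show ?thesis using that[of 0] Inr gromov_sequences_visual_self by auto
qed

text \<open>Chordal distances along one chosen pair of representatives form a Cauchy sequence by
  \<open>chordal_diff\<close>; any other pair has the same limit, its distance to the chosen one
  tending to 0.\<close>

lemma representatives_chordal_limit:
  assumes p: "p \<in> bordification" and q: "q \<in> bordification"
  obtains l where "\<And>u v. u \<in> representatives p \<Longrightarrow> v \<in> representatives q \<Longrightarrow>
    ((\<lambda>(i, j). chordal w (u i) (v j)) \<longlongrightarrow> l) (sequentially \<times>\<^sub>F sequentially)"
proof -
  obtain u0 v0 where u0: "u0 \<in> representatives p" and v0: "v0 \<in> representatives q"
    using representatives_nonempty p q by blast
  define c where "c n = chordal w (u0 n) (v0 n)" for n
  have "((\<lambda>(i, j). chordal w (u0 i) (u0 j) + chordal w (v0 i) (v0 j)) \<longlongrightarrow> 0) (sequentially \<times>\<^sub>F sequentially)"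
    using tendsto_add_zero[OF representatives_chordal[OF p u0 u0] representatives_chordal[OF q v0 v0]]
    by (simp add: case_prod_unfold)
  then have "\<exists>N. \<forall>m\<ge>N. \<forall>n\<ge>N. \<bar>chordal w (u0 n) (u0 m) + chordal w (v0 n) (v0 m)\<bar> < r" if "0 < r" for r
    using that by (auto simp: tendsto_iff eventually_prod_sequentially)
  then have "Cauchy c"
    unfolding Cauchy_def dist_real_def c_def
    by (meson chordal_diff abs_ge_self order_le_less_trans)
  then obtain l where l: "c \<longlonglongrightarrow> l" by (auto simp: Cauchy_convergent_iff convergent_def)
  show thesis
  proof (rule that)
    fix u v assume u: "u \<in> representatives p" and v: "v \<in> representatives q"
    have 1: "((\<lambda>x. chordal w (u (fst x)) (u0 (fst x))) \<longlongrightarrow> 0) (sequentially \<times>\<^sub>F sequentially)"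
      by (rule filterlim_compose[OF tendsto_prod_sequentially_diagonal[OF
              representatives_chordal[OF p u u0]] filterlim_fst])
    have 2: "((\<lambda>x. \<bar>c (fst x) - l\<bar>) \<longlongrightarrow> 0) (sequentially \<times>\<^sub>F sequentially)"
      by (intro tendsto_rabs_zero LIM_zero filterlim_compose[OF l filterlim_fst])
    \<comment> \<open>Both reference points carry the index \<open>i\<close>: the first distance is
      then a diagonal limit, the second a double limit.\<close>
    have "((\<lambda>(i, j). chordal w (u i) (u0 i) + chordal w (v0 i) (v j) + \<bar>c i - l\<bar>) \<longlongrightarrow> 0)
        (sequentially \<times>\<^sub>F sequentially)"
      using tendsto_add_zero[OF tendsto_add_zero[OF 1 representatives_chordal[OF q v0 v]] 2]
      by (simp add: case_prod_unfold)
    moreover have "\<bar>chordal w (u i) (v j) - l\<bar> \<le> chordal w (u i) (u0 i) + chordal w (v0 i) (v j) + \<bar>c i - l\<bar>"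
      for i j
      using chordal_diff[of w "u i" "v j" "u0 i" "v0 i"]
      by (simp add: c_def chordal_commute[of w "v j"])
    ultimately have "((\<lambda>(i, j). \<bar>chordal w (u i) (v j) - l\<bar>) \<longlongrightarrow> 0) (sequentially \<times>\<^sub>F sequentially)"
      by (rule tendsto_0_sandwich_prod[OF _ abs_ge_zero])
    then show "((\<lambda>(i, j). chordal w (u i) (v j)) \<longlongrightarrow> l) (sequentially \<times>\<^sub>F sequentially)"
      by (simp add: case_prod_unfold tendsto_rabs_zero_iff LIM_zero_iff)
  qed
qed

subsection \<open>The extended Gromov product as a limit\<close>

text \<open>The inverse of \<open>\<lambda>t. exp (- \<epsilon> * t)\<close>, including infinity.
  The value infinity at negative arguments makes it continuous on the whole real line.\<close>

definition neg_log :: "real \<Rightarrow> ereal" where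
  "neg_log r = (if r \<le> 0 then \<infinity> else ereal (- ln r / \<epsilon>))"

lemma neg_log_visual: "neg_log (visual w x y) = ereal (gromov_product w x y)"
  using pos by (simp add: neg_log_def visual_def)

lemma isCont_neg_log: "isCont neg_log r"
proof -
  consider "r < 0" | "r = 0" | "0 < r" by linarith
  then show ?thesis
  proof cases
    case 1
    then have "eventually (\<lambda>x. neg_log x = \<infinity>) (nhds r)"
      by (intro eventually_nhds_in_open[of "{..<0}", THEN eventually_mono]) (auto simp: neg_log_def)
    then show ?thesis by (rule isCont_cong[THEN iffD2]) (rule continuous_const)
  next
    case 2
    have "eventually (\<lambda>x. ereal M < neg_log x) (at 0)" for M
    proof -
      \<comment> \<open>The bound is the point at which \<open>neg_log\<close> equals
        \<open>M\<close>.\<close>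
      have "eventually (\<lambda>x. x < exp (- \<epsilon> * M)) (at (0::real))"
        by (rule order_tendstoD(2)[OF tendsto_ident_at]) simp
      then show ?thesis
      proof eventually_elim
        case (elim x)
        show ?case
        proof (cases "x \<le> 0")
          case False
          then have "ln x < - \<epsilon> * M" using elim by (metis exp_gt_zero ln_exp ln_less_cancel_iff not_le)
          then show ?thesis using False pos by (simp add: neg_log_def field_simps)
        qed (simp add: neg_log_def)
      qed
    qed
    then show ?thesis using 2 by (simp add: isCont_def neg_log_def tendsto_PInfty)
  next
    case 3
    then have "eventually (\<lambda>x. neg_log x = ereal (- ln x / \<epsilon>)) (nhds r)"
      by (intro eventually_nhds_in_open[of "{0<..}", THEN eventually_mono]) (auto simp: neg_log_def)
    moreover have "isCont (\<lambda>x. ereal (- ln x / \<epsilon>)) r"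
      using 3 pos by (auto simp: isCont_def intro!: tendsto_intros)
    ultimately show ?thesis by (rule isCont_cong[THEN iffD2])
  qed
qed

text \<open>The lower limits defining the extended product are limits with the same value for all
  representatives, so the infima range over a constant.\<close>

lemma representatives_limit:
  assumes p: "p \<in> bordification" and q: "q \<in> bordification"
  shows gromov_product_ext_eq: "gromov_product_ext w p q = neg_log (visual_metametric \<epsilon> w p q)"
    and tendsto_visual_metametric:
      "\<And>u v. u \<in> representatives p \<Longrightarrow> v \<in> representatives q \<Longrightarrow>
        ((\<lambda>(i, j). visual w (u i) (v j)) \<longlongrightarrow> visual_metametric \<epsilon> w p q) (sequentially \<times>\<^sub>F sequentially)"
proof -
  obtain l where l: "\<And>u v. u \<in> representatives p \<Longrightarrow> v \<in> representatives q \<Longrightarrow>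
      ((\<lambda>(i, j). chordal w (u i) (v j)) \<longlongrightarrow> l) (sequentially \<times>\<^sub>F sequentially)"
    using representatives_chordal_limit[OF p q] by blast
  obtain a where a: "\<And>u. u \<in> representatives p \<Longrightarrow> (\<lambda>i. visual w (u i) (u i)) \<longlonglongrightarrow> a"
    using representatives_visual_self[OF p] by blast
  obtain b where b: "\<And>u. u \<in> representatives q \<Longrightarrow> (\<lambda>i. visual w (u i) (u i)) \<longlonglongrightarrow> b"
    using representatives_visual_self[OF q] by blast
  define m where "m = sqrt (l\<^sup>2 + (a\<^sup>2 + b\<^sup>2) / 2)"
  have m: "((\<lambda>(i, j). visual w (u i) (v j)) \<longlongrightarrow> m) (sequentially \<times>\<^sub>F sequentially)"
    if "u \<in> representatives p" "v \<in> representatives q" for u v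
    unfolding m_def using that by (intro tendsto_visual l a b)
  have "Liminf (sequentially \<times>\<^sub>F sequentially) (\<lambda>(i, j). ereal (gromov_product w (u i) (v j))) = neg_log m"
    if "u \<in> representatives p" "v \<in> representatives q" for u v
    using isCont_tendsto_compose[OF isCont_neg_log m[OF that]]
    by (intro lim_imp_Liminf) (simp_all add: case_prod_unfold neg_log_visual prod_filter_eq_bot)
  then have ext: "gromov_product_ext w p q = neg_log m"
    using representatives_nonempty[OF p] representatives_nonempty[OF q]
    by (simp add: gromov_product_ext_def)
  have "0 \<le> m" by (simp add: m_def)
  then have "visual_metametric \<epsilon> w p q = m"
    using pos by (auto simp: visual_metametric_def ext neg_log_def)
  with ext m show "gromov_product_ext w p q = neg_log (visual_metametric \<epsilon> w p q)"
    and "\<And>u v. u \<in> representatives p \<Longrightarrow> v \<in> representatives q \<Longrightarrow>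
        ((\<lambda>(i, j). visual w (u i) (v j)) \<longlongrightarrow> visual_metametric \<epsilon> w p q) (sequentially \<times>\<^sub>F sequentially)"
    by simp_all
qed

lemma visual_metametric_Inl_Inl: "visual_metametric \<epsilon> w (Inl x) (Inl y) = visual w x y"
  by (simp add: visual_metametric_def gromov_product_ext_Inl_Inl visual_def)

text \<open>A single sequence is enough to pass identities and inequalities for
  \<open>visual\<close> to the bordification.\<close>

lemma visual_metametric_diagonal:
  assumes "p \<in> bordification" "q \<in> bordification" "u \<in> representatives p" "v \<in> representatives q"
  shows "(\<lambda>i. visual w (u i) (v i)) \<longlonglongrightarrow> visual_metametric \<epsilon> w p q"
  by (rule tendsto_prod_sequentially_diagonal[OF tendsto_visual_metametric[OF assms]])

text \<open>By \<open>gromov_equivalentI\<close>, the double limit is 0 exactly when the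
  representatives are equivalent.\<close>

lemma visual_metametric_eq_0_iff:
  fixes w :: 'a
  assumes "\<xi> \<in> gromov_boundary" "\<eta> \<in> gromov_boundary"
  shows "visual_metametric \<epsilon> w (Inr \<xi>) (Inr \<eta>) = 0 \<longleftrightarrow> \<xi> = \<eta>"
proof -
  have bord: "Inr \<xi> \<in> bordification" "Inr \<eta> \<in> bordification"
    using assms by (auto simp: bordification_def)
  then obtain u v where uv: "u \<in> \<xi>" "v \<in> \<eta>" using representatives_nonempty by fastforce
  have lim: "((\<lambda>(i, j). visual w (u i) (v j)) \<longlongrightarrow> visual_metametric \<epsilon> w (Inr \<xi>) (Inr \<eta>))
      (sequentially \<times>\<^sub>F sequentially)"
    using tendsto_visual_metametric[OF bord] uv by simp
  have "gromov_equivalent u v \<longleftrightarrow> visual_metametric \<epsilon> w (Inr \<xi>) (Inr \<eta>) = 0"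
    using lim gromov_equivalentI[of w u v]
      tendsto_unique[OF _ lim, of 0]
    by (auto simp: prod_filter_eq_bot gromov_equivalent_iff)
  then show ?thesis using gromov_boundary_eq_iff[OF assms uv] by simp
qed

lemma visual_metametric_change_base:
  fixes w :: 'a
  assumes "p \<in> bordification" "q \<in> bordification"
  shows "visual_metametric \<epsilon> w p q \<le> exp (\<epsilon> * dist w w') * visual_metametric \<epsilon> w' p q"
proof -
  obtain u v where uv: "u \<in> representatives p" "v \<in> representatives q"
    using assms[THEN representatives_nonempty] by blast
  show ?thesis
    by (rule LIMSEQ_le[OF visual_metametric_diagonal[OF assms uv]
          tendsto_mult_left[OF visual_metametric_diagonal[OF assms uv]]])
       (auto simp: visual_change_base)
qed

subsection \<open>The chordal pseudometric on the bordification\<close>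

definition chordal_ext :: "'a \<Rightarrow> 'a bord \<Rightarrow> 'a bord \<Rightarrow> real" where
  "chordal_ext w p q = sqrt ((visual_metametric \<epsilon> w p q)\<^sup>2
     - ((visual_metametric \<epsilon> w p p)\<^sup>2 + (visual_metametric \<epsilon> w q q)\<^sup>2) / 2)"

lemma chordal_ext_limit:
  assumes "p \<in> bordification" "q \<in> bordification" "u \<in> representatives p" "v \<in> representatives q"
  shows "(\<lambda>i. chordal w (u i) (v i)) \<longlonglongrightarrow> chordal_ext w p q"
proof -
  note lims = visual_metametric_diagonal[OF assms, of w]
    visual_metametric_diagonal[OF assms(1,1) assms(3,3), of w]
    visual_metametric_diagonal[OF assms(2,2) assms(4,4), of w]
  show ?thesis
    unfolding chordal_def chordal_ext_def
    by (intro tendsto_real_sqrt tendsto_diff tendsto_divide tendsto_add tendsto_power tendsto_const lims) simp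
qed

lemma chordal_ext_commute: "chordal_ext w p q = chordal_ext w q p"
  by (simp add: chordal_ext_def visual_metametric_commute[of \<epsilon> w p q] add.commute)

lemma chordal_ext_triangle:
  assumes "p \<in> bordification" "q \<in> bordification" "r \<in> bordification"
  shows "chordal_ext w p r \<le> chordal_ext w p q + chordal_ext w q r"
proof -
  obtain u v t where reps: "u \<in> representatives p" "v \<in> representatives q" "t \<in> representatives r"
    using assms[THEN representatives_nonempty] by blast
  show ?thesis
    by (rule LIMSEQ_le[OF chordal_ext_limit[OF assms(1,3) reps(1,3)]
          tendsto_add[OF chordal_ext_limit[OF assms(1,2) reps(1,2)] chordal_ext_limit[OF assms(2,3) reps(2,3)]]])
       (simp add: chordal_triangle)
qed

lemma chordal_ext_bounds:
  assumes "p \<in> bordification" "q \<in> bordification"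
  shows "(chordal_ext w p q)\<^sup>2 = (visual_metametric \<epsilon> w p q)\<^sup>2
     - ((visual_metametric \<epsilon> w p p)\<^sup>2 + (visual_metametric \<epsilon> w q q)\<^sup>2) / 2"
    and "chordal_ext w p q \<le> visual_metametric \<epsilon> w p q"
    and "visual_metametric \<epsilon> w p p \<le> sqrt 2 * visual_metametric \<epsilon> w p q"
proof -
  obtain u v where uv: "u \<in> representatives p" "v \<in> representatives q"
    using assms[THEN representatives_nonempty] by blast
  note lims = chordal_ext_limit[OF assms uv, of w] visual_metametric_diagonal[OF assms uv, of w]
    visual_metametric_diagonal[OF assms(1,1) uv(1,1), of w]
    visual_metametric_diagonal[OF assms(2,2) uv(2,2), of w]
  show "chordal_ext w p q \<le> visual_metametric \<epsilon> w p q"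
    by (rule LIMSEQ_le[OF lims(1,2)]) (auto simp: chordal_le_visual)
  show "visual_metametric \<epsilon> w p p \<le> sqrt 2 * visual_metametric \<epsilon> w p q"
    by (rule LIMSEQ_le[OF lims(3) tendsto_mult_left[OF lims(2)]]) (auto simp: visual_self_le)
  \<comment> \<open>Rather than checking the sign of the radicand in \<open>chordal_ext\<close>, two
    limits of the same sequence are compared.\<close>
  have "(\<lambda>i. (chordal w (u i) (v i))\<^sup>2) \<longlonglongrightarrow> (visual_metametric \<epsilon> w p q)\<^sup>2
     - ((visual_metametric \<epsilon> w p p)\<^sup>2 + (visual_metametric \<epsilon> w q q)\<^sup>2) / 2"
    unfolding chordal_square
    by (intro tendsto_diff tendsto_divide tendsto_add tendsto_power tendsto_const lims) simp
  then show "(chordal_ext w p q)\<^sup>2 = (visual_metametric \<epsilon> w p q)\<^sup>2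
     - ((visual_metametric \<epsilon> w p p)\<^sup>2 + (visual_metametric \<epsilon> w q q)\<^sup>2) / 2"
    by (rule LIMSEQ_unique[OF tendsto_power[OF lims(1)]])
qed

lemma visual_metametric_eq:
  assumes "p \<in> bordification" "q \<in> bordification"
  shows "visual_metametric \<epsilon> w p q = sqrt ((chordal_ext w p q)\<^sup>2
     + ((visual_metametric \<epsilon> w p p)\<^sup>2 + (visual_metametric \<epsilon> w q q)\<^sup>2) / 2)"
  using chordal_ext_bounds(1)[OF assms, of w] visual_metametric_nonneg[of \<epsilon> w p q] by simp

text \<open>The diagonal values vanish at boundary points. Hence the metametric inherits the
  triangle inequality there.\<close>

lemma visual_metametric_boundary_eq_chordal_ext:
  assumes "\<xi> \<in> gromov_boundary" "\<eta> \<in> gromov_boundary"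
  shows "visual_metametric \<epsilon> w (Inr \<xi>) (Inr \<eta>) = chordal_ext w (Inr \<xi>) (Inr \<eta>)"
  using visual_metametric_eq_0_iff[OF assms(1,1), of w] visual_metametric_eq_0_iff[OF assms(2,2), of w]
  by (simp add: chordal_ext_def visual_metametric_nonneg)

section \<open>Metric and Moebius structure of the boundary\<close>

lemma Metric_space_boundary:
  fixes w :: 'a
  shows "Metric_space (Inr ` gromov_boundary) (visual_metametric \<epsilon> w)"
proof
  fix p q r :: "'a bord"
  show "0 \<le> visual_metametric \<epsilon> w p q" by (rule visual_metametric_nonneg)
  show "visual_metametric \<epsilon> w p q = visual_metametric \<epsilon> w q p" by (rule visual_metametric_commute)
  assume p: "p \<in> Inr ` gromov_boundary" and q: "q \<in> Inr ` gromov_boundary"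
  then show "visual_metametric \<epsilon> w p q = 0 \<longleftrightarrow> p = q"
    by (auto simp: visual_metametric_eq_0_iff)
  assume "r \<in> Inr ` gromov_boundary"
  with p q show "visual_metametric \<epsilon> w p r \<le> visual_metametric \<epsilon> w p q + visual_metametric \<epsilon> w q r"
    by (auto simp: visual_metametric_boundary_eq_chordal_ext bordification_def intro!: chordal_ext_triangle)
qed

text \<open>On the space, the distance from \<open>w\<close> to each of the four points enters
  numerator and denominator of the cross-ratio once, and cancels.\<close>

lemma moebius_equivalent_boundary:
  fixes w w' :: 'a
  shows "moebius_equivalent_on (Inr ` gromov_boundary) (visual_metametric \<epsilon> w) (visual_metametric \<epsilon> w')"
  unfolding moebius_equivalent_on_def
proof (intro ballI impI)
  fix a a' b b' :: "'a bord"
  assume S: "a \<in> Inr ` gromov_boundary" "a' \<in> Inr ` gromov_boundary"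
    "b \<in> Inr ` gromov_boundary" "b' \<in> Inr ` gromov_boundary" and ne: "a \<noteq> b' \<and> b \<noteq> a'"
  then have bord: "a \<in> bordification" "a' \<in> bordification" "b \<in> bordification" "b' \<in> bordification"
    by (auto simp: bordification_def)
  then obtain s s' t t' where reps: "s \<in> representatives a" "s' \<in> representatives a'"
      "t \<in> representatives b" "t' \<in> representatives b'"
    using representatives_nonempty by (meson ex_in_conv)
  let ?c = "\<lambda>w i. metric_cross_ratio (visual w) (s i) (s' i) (t i) (t' i)"
  \<comment> \<open>The conditions \<open>a \<noteq> b'\<close> and \<open>b \<noteq> a'\<close>
    keep the limit of the denominator away from 0.\<close>
  have lim: "?c w \<longlonglongrightarrow> metric_cross_ratio (visual_metametric \<epsilon> w) a a' b b'" for w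
    unfolding metric_cross_ratio_def
    by (intro tendsto_divide tendsto_mult visual_metametric_diagonal bord reps)
       (use S ne in \<open>auto simp: visual_metametric_eq_0_iff\<close>)
  have "?c w = ?c w'"
    by (rule ext) (simp add: metric_cross_ratio_def visual_def gromov_product_def field_simps flip: exp_add exp_diff)
  then show "metric_cross_ratio (visual_metametric \<epsilon> w) a a' b b'
      = metric_cross_ratio (visual_metametric \<epsilon> w') a a' b b'"
    using LIMSEQ_unique[OF lim[of w]] lim[of w'] by simp
qed

subsection \<open>Continuity\<close>

lemma continuous_visual: "isCont (\<lambda>y. visual w (f y) (g y)) x"
  if "isCont f x" "isCont g x" for f g :: "'a \<Rightarrow> 'a"
  unfolding visual_def gromov_product_def using that by (intro continuous_intros) simp_all

text \<open>By the change of base point, a condition that only bounds \<open>visual_metametric \<epsilon> w p \<xi>\<close>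
  from above defines a neighbourhood of \<open>\<xi>\<close>.\<close>

lemma bord_openI:
  fixes w :: 'a
  assumes "U \<subseteq> bordification" "open (Inl -` U)"
    and bdry: "\<And>\<xi>. \<xi> \<in> gromov_boundary \<Longrightarrow> Inr \<xi> \<in> U \<Longrightarrow>
      \<exists>r>0. \<forall>p\<in>bordification. visual_metametric \<epsilon> w p (Inr \<xi>) < r \<longrightarrow> p \<in> U"
  shows "openin bord_topology U"
  unfolding openin_bord_topology bord_open_def
proof (intro conjI ballI impI allI)
  fix \<xi> :: "(nat \<Rightarrow> 'a) set" and w'
  assume \<xi>: "\<xi> \<in> gromov_boundary" "Inr \<xi> \<in> U"
  then obtain r where r: "0 < r" "\<And>p. p \<in> bordification \<Longrightarrow> visual_metametric \<epsilon> w p (Inr \<xi>) < r \<Longrightarrow> p \<in> U"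
    using bdry by blast
  \<comment> \<open>Divided by the factor lost in the change of base, so that a bound
    \<open>r'\<close> at \<open>w'\<close> gives the bound \<open>r\<close> at \<open>w\<close>. The
    threshold used below is \<open>neg_log r'\<close>.\<close>
  define r' where "r' = r / exp (\<epsilon> * dist w w')"
  have r': "0 < r'" using r by (simp add: r'_def)
  have "p \<in> U" if p: "p \<in> bordification" and less: "ereal (- ln r' / \<epsilon>) < gromov_product_ext w' p (Inr \<xi>)" for p
  proof -
    let ?V = "visual_metametric \<epsilon> w' p (Inr \<xi>)"
    have bord: "Inr \<xi> \<in> bordification" using \<xi> by (simp add: bordification_def)
    have "?V < r'"
    proof (cases "?V \<le> 0")
      case False
      then have "ln ?V < ln r'"
        using less pos unfolding gromov_product_ext_eq[OF p bord] neg_log_def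
        by (simp add: divide_less_cancel)
      then show ?thesis using False r' by simp
    qed (use r' in linarith)
    then have "exp (\<epsilon> * dist w w') * ?V < r"
      by (simp add: r'_def field_simps)
    then show ?thesis
      using r(2)[OF p] visual_metametric_change_base[OF p bord, of w w'] by linarith
  qed
  then show "\<exists>t. {p \<in> bordification. ereal t < gromov_product_ext w' p (Inr \<xi>)} \<subseteq> U" by blast
qed (use assms in auto)

text \<open>Inside the space the chordal distance is continuous for \<open>dist\<close>; near a
  boundary point it is dominated by the metametric. In both cases the triangle inequality does the
  rest.\<close>

lemma openin_chordal_ball:
  assumes p0: "p0 \<in> bordification"
  shows "openin bord_topology {p \<in> bordification. chordal_ext w p0 p < r}" (is "openin _ ?U")
proof (rule bord_openI)
  show "?U \<subseteq> bordification" by auto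
  show "open (Inl -` ?U)"
    unfolding open_dist
  proof (intro ballI)
    fix x assume x: "x \<in> Inl -` ?U"
    have bord: "Inl y \<in> bordification" for y :: 'a by (simp add: bordification_def)
    have "isCont (\<lambda>y. chordal_ext w (Inl x) (Inl y)) x"
      unfolding chordal_ext_def visual_metametric_Inl_Inl
      by (intro continuous_intros continuous_visual) simp_all
    then have "\<forall>s>0. \<exists>e>0. \<forall>y. dist y x < e \<longrightarrow>
        dist (chordal_ext w (Inl x) (Inl y)) (chordal_ext w (Inl x) (Inl x)) < s"
      by (simp only: continuous_at_eps_delta)
    moreover have "chordal_ext w (Inl x) (Inl x) = 0" by (simp add: chordal_ext_def)
    moreover have "0 < r - chordal_ext w p0 (Inl x)" using x by simp
    ultimately obtain e where e: "0 < e"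
        "\<And>y. dist y x < e \<Longrightarrow> \<bar>chordal_ext w (Inl x) (Inl y)\<bar> < r - chordal_ext w p0 (Inl x)"
      by (metis dist_0_norm dist_commute real_norm_def)
    have "Inl y \<in> ?U" if "dist y x < e" for y
    proof -
      have "chordal_ext w p0 (Inl y) < r"
        using e(2)[OF that] chordal_ext_triangle[OF p0 bord[of x] bord[of y], of w] by linarith
      then show ?thesis using bord by simp
    qed
    with e(1) show "\<exists>e>0. \<forall>y. dist y x < e \<longrightarrow> y \<in> Inl -` ?U" by blast
  qed
  fix \<xi> :: "(nat \<Rightarrow> 'a) set" assume \<xi>: "\<xi> \<in> gromov_boundary" "Inr \<xi> \<in> ?U"
  show "\<exists>s>0. \<forall>p\<in>bordification. visual_metametric \<epsilon> w p (Inr \<xi>) < s \<longrightarrow> p \<in> ?U"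
  proof (intro exI[of _ "r - chordal_ext w p0 (Inr \<xi>)"] conjI ballI impI)
    fix p assume p: "p \<in> bordification" "visual_metametric \<epsilon> w p (Inr \<xi>) < r - chordal_ext w p0 (Inr \<xi>)"
    then show "p \<in> ?U"
      using chordal_ext_triangle[of p0 "Inr \<xi>" p w] \<xi>(2) p0 chordal_ext_bounds(2)[of p "Inr \<xi>" w]
      by (simp add: chordal_ext_commute[of w p])
  qed (use \<xi> in auto)
qed

text \<open>A pseudometric with open balls is jointly continuous: balls of radius
  \<open>r / 2\<close> around both points change the value by less than \<open>r\<close>.\<close>

lemma continuous_map_chordal_ext:
  "continuous_map (prod_topology bord_topology bord_topology) euclideanreal (\<lambda>(p, q). chordal_ext w p q)"
  unfolding Met_TC.continuous_map_to_metric[unfolded mtopology_is_euclidean] mball_eq_ball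
proof (intro ballI allI impI)
  fix pq :: "'a bord \<times> 'a bord" and r :: real
  assume "pq \<in> topspace (prod_topology bord_topology bord_topology)" and r: "0 < r"
  then obtain p q where pq: "pq = (p, q)" and p: "p \<in> bordification" and q: "q \<in> bordification"
    by (auto simp: topspace_bord_topology)
  let ?B = "\<lambda>p. {p' \<in> bordification. chordal_ext w p p' < r / 2}"
  have "(case y of (p, q) \<Rightarrow> chordal_ext w p q) \<in> ball (case pq of (p, q) \<Rightarrow> chordal_ext w p q) r"
    if y: "y \<in> ?B p \<times> ?B q" for y
  proof -
    obtain p' q' where y': "y = (p', q')" and p': "p' \<in> bordification" "chordal_ext w p p' < r / 2"
      and q': "q' \<in> bordification" "chordal_ext w q q' < r / 2"
      using y by auto
    show ?thesis
      using chordal_ext_triangle[OF p p'(1) q, of w] chordal_ext_triangle[OF p'(1) q'(1) q, of w]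
        chordal_ext_triangle[OF p'(1) p q'(1), of w] chordal_ext_triangle[OF p q q'(1), of w] p'(2) q'(2)
      by (simp add: y' pq dist_real_def chordal_ext_commute[of w p' p] chordal_ext_commute[of w q' q] abs_less_iff)
  qed
  moreover have "pq \<in> ?B p \<times> ?B q"
    using r p q by (simp add: pq chordal_ext_def)
  moreover have "openin (prod_topology bord_topology bord_topology) (?B p \<times> ?B q)"
    unfolding openin_prod_Times_iff using openin_chordal_ball p q by blast
  ultimately show "\<exists>U. openin (prod_topology bord_topology bord_topology) U \<and> pq \<in> U \<and>
      (\<forall>y\<in>U. (case y of (p, q) \<Rightarrow> chordal_ext w p q) \<in> ball (case pq of (p, q) \<Rightarrow> chordal_ext w p q) r)"
    by blast
qed

text \<open>At boundary points the value is 0: upper semicontinuity there comes from the factor sqrt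
  2 in \<open>chordal_ext_bounds\<close>, lower semicontinuity from nonnegativity.\<close>

lemma continuous_map_visual_metametric_self:
  fixes w :: 'a
  shows "continuous_map bord_topology euclideanreal (\<lambda>p. visual_metametric \<epsilon> w p p)"
  unfolding continuous_map_upper_lower_semicontinuous_lt topspace_bord_topology
proof (intro allI conjI)
  fix r :: real
  have self: "visual_metametric \<epsilon> w (Inr \<xi>) (Inr \<xi>) = 0" if "\<xi> \<in> gromov_boundary" for \<xi>
    using that by (simp add: visual_metametric_eq_0_iff)
  have cont: "continuous_on UNIV (\<lambda>x. visual w x x)"
    by (simp add: continuous_on_eq_continuous_at continuous_visual)
  have Inl: "Inl -` {p \<in> bordification. P (visual_metametric \<epsilon> w p p)} = {x. P (visual w x x)}" for P
    by (auto simp: bordification_def visual_metametric_Inl_Inl)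
  show "openin bord_topology {p \<in> bordification. visual_metametric \<epsilon> w p p < r}"
  proof (rule bord_openI)
    show "open (Inl -` {p \<in> bordification. visual_metametric \<epsilon> w p p < r})"
      unfolding Inl[of "\<lambda>y. y < r"] by (intro open_Collect_less cont continuous_intros)
    fix \<xi> :: "(nat \<Rightarrow> 'a) set"
    assume \<xi>: "\<xi> \<in> gromov_boundary" "Inr \<xi> \<in> {p \<in> bordification. visual_metametric \<epsilon> w p p < r}"
    then have r: "0 < r" using self by simp
    show "\<exists>s>0. \<forall>p\<in>bordification. visual_metametric \<epsilon> w p (Inr \<xi>) < s \<longrightarrow>
        p \<in> {p \<in> bordification. visual_metametric \<epsilon> w p p < r}"
    proof (intro exI[of _ "r / sqrt 2"] conjI ballI impI)
      fix p assume p: "p \<in> bordification" "visual_metametric \<epsilon> w p (Inr \<xi>) < r / sqrt 2"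
      then show "p \<in> {p \<in> bordification. visual_metametric \<epsilon> w p p < r}"
        using chordal_ext_bounds(3)[of p "Inr \<xi>" w] \<xi>(2) by (simp add: field_simps)
    qed (use r in simp)
  qed auto
  show "openin bord_topology {p \<in> bordification. r < visual_metametric \<epsilon> w p p}"
  proof (rule bord_openI)
    show "open (Inl -` {p \<in> bordification. r < visual_metametric \<epsilon> w p p})"
      unfolding Inl[of "\<lambda>y. r < y"] by (intro open_Collect_less cont continuous_intros)
    fix \<xi> :: "(nat \<Rightarrow> 'a) set"
    assume \<xi>: "\<xi> \<in> gromov_boundary" "Inr \<xi> \<in> {p \<in> bordification. r < visual_metametric \<epsilon> w p p}"
    \<comment> \<open>The set is then the whole bordification, so any radius will do.\<close>
    then have "r < 0" using self by simp
    then show "\<exists>s>0. \<forall>p\<in>bordification. visual_metametric \<epsilon> w p (Inr \<xi>) < s \<longrightarrow>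
        p \<in> {p \<in> bordification. r < visual_metametric \<epsilon> w p p}"
      by (intro exI[of _ 1]) (auto intro: less_le_trans visual_metametric_nonneg)
  qed auto
qed

text \<open>By \<open>visual_metametric_eq\<close> the metametric is built from the chordal distance
  and the diagonal values, all continuous; \<open>neg_log\<close> then yields the product.\<close>

lemma continuous_map_gromov_product_ext:
  fixes w :: 'a
  shows "continuous_map (prod_topology bord_topology bord_topology) euclidean (\<lambda>(p, q). gromov_product_ext w p q)"
proof -
  let ?T = "prod_topology bord_topology bord_topology"
  have "continuous_map ?T euclideanreal (\<lambda>x. visual_metametric \<epsilon> w (fst x) (fst x))"
    "continuous_map ?T euclideanreal (\<lambda>x. visual_metametric \<epsilon> w (snd x) (snd x))"
    using continuous_map_compose[OF continuous_map_fst continuous_map_visual_metametric_self]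
      continuous_map_compose[OF continuous_map_snd continuous_map_visual_metametric_self]
    by (simp_all add: o_def)
  then have "continuous_map ?T euclideanreal (\<lambda>x. sqrt ((chordal_ext w (fst x) (snd x))\<^sup>2
     + ((visual_metametric \<epsilon> w (fst x) (fst x))\<^sup>2 + (visual_metametric \<epsilon> w (snd x) (snd x))\<^sup>2) / 2))"
    using continuous_map_chordal_ext
    by (intro continuous_map_sqrt continuous_map_add continuous_map_real_divide continuous_map_real_pow
        continuous_map_canonical_const) (simp_all add: case_prod_unfold)
  then have "continuous_map ?T euclideanreal (\<lambda>x. visual_metametric \<epsilon> w (fst x) (snd x))"
    by (rule continuous_map_eq)
       (auto simp: topspace_bord_topology intro!: visual_metametric_eq[symmetric])
  moreover have "continuous_map euclideanreal euclidean neg_log"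
    by (simp add: continuous_on_eq_continuous_at isCont_neg_log)
  ultimately have "continuous_map ?T euclidean (neg_log \<circ> (\<lambda>x. visual_metametric \<epsilon> w (fst x) (snd x)))"
    by (rule continuous_map_compose)
  then show ?thesis
    by (rule continuous_map_eq) (auto simp: topspace_bord_topology gromov_product_ext_eq)
qed

end

theorem proposition4p13:
  fixes \<epsilon> :: real
  assumes "\<epsilon> > 0"
    and "kernel_of_hyperbolic_type (\<lambda>x y :: 'a::metric_space. exp (\<epsilon> * dist x y))"
  shows "coarsely_strongly_hyperbolic TYPE('a) 3 \<epsilon>
    \<and> gromov_hyperbolic TYPE('a)
    \<and> (\<forall>w :: 'a.
         continuous_map (prod_topology bord_topology bord_topology) euclidean
           (\<lambda>(p, q). gromov_product_ext w p q)
         \<and> (\<forall>x y. gromov_product_ext w (Inl x) (Inl y) = ereal (gromov_product w x y)))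
    \<and> (\<forall>w :: 'a. Metric_space (Inr ` gromov_boundary) (visual_metametric \<epsilon> w))
    \<and> (\<forall>w w' :: 'a. moebius_equivalent_on (Inr ` gromov_boundary)
         (visual_metametric \<epsilon> w) (visual_metametric \<epsilon> w'))"
proof -
  interpret exp_dist_hyperbolic_type \<epsilon> "TYPE('a)"
    using assms by unfold_locales
  show ?thesis
    using coarsely_strongly_hyperbolic gromov_hyperbolic continuous_map_gromov_product_ext
      gromov_product_ext_Inl_Inl Metric_space_boundary moebius_equivalent_boundary by blast
qed

end
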